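(* Let $a,b\geq 2$ be multiplicatively independent integers. Let $\mu$ be a non-atomic Borel probability measure on $[0,1]$ that is invariant and ergodic under $T_a$. Then for $\mu$-a.e. $x$ the orbit $\{T_b^n x\}_{n\geq 0}$ is dense in $[0,1]$.
   Context: For an integer $a\ge 2$, $T_a:[0,1]\to[0,1]$ is the map $T_a x = ax \bmod 1$. Integers $a,b\geq 2$ are multiplicatively independent if $a^m\neq b^n$ for all positive integers $m,n$. *)

theory Defs
  imports "HOL-Probability.Probability"
begin

text \<open>On \<open>{0..1}\<close> as a set, so that \<open>times_map a 1 = 0\<close>: the endpoints are not identified.\<close>

definition times_map :: "int \<Rightarrow> real \<Rightarrow> real" where
  "times_map a x = frac (of_int a * x)"

definition multiplicatively_independent :: "int \<Rightarrow> int \<Rightarrow> bool" where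
  "multiplicatively_independent a b \<longleftrightarrow>
     (\<forall>m n :: nat. 0 < m \<longrightarrow> 0 < n \<longrightarrow> a ^ m \<noteq> b ^ n)"

definition is_atom :: "'a measure \<Rightarrow> 'a set \<Rightarrow> bool" where
  "is_atom M A \<longleftrightarrow> A \<in> sets M \<and> 0 < emeasure M A \<and>
     (\<forall>B \<in> sets M. B \<subseteq> A \<longrightarrow> emeasure M B = 0 \<or> emeasure M (A - B) = 0)"

definition non_atomic :: "'a measure \<Rightarrow> bool" where
  "non_atomic M \<longleftrightarrow> (\<nexists>A. is_atom M A)"

definition invariant_under :: "'a measure \<Rightarrow> ('a \<Rightarrow> 'a) \<Rightarrow> bool" where
  "invariant_under M T \<longleftrightarrow> T \<in> measurable M M \<and>
     (\<forall>A \<in> sets M. emeasure M (T -` A \<inter> space M) = emeasure M A)"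

definition ergodic_under :: "'a measure \<Rightarrow> ('a \<Rightarrow> 'a) \<Rightarrow> bool" where
  "ergodic_under M T \<longleftrightarrow>
     (\<forall>A \<in> sets M. T -` A \<inter> space M = A \<longrightarrow>
        emeasure M A = 0 \<or> emeasure M (space M - A) = 0)"

definition orbit_of :: "('a \<Rightarrow> 'a) \<Rightarrow> 'a \<Rightarrow> 'a set" where
  "orbit_of T x = {(T ^^ n) x | n. True}"

end

theory Submission
  imports Defs "HOL-Number_Theory.Residues"
begin

text \<open>
  For \<open>x\<close> in \<open>[0,1]\<close> let \<open>C\<^sub>x\<close> be the closure of the \<open>T\<^sub>b\<close>-orbit, viewed as a closed 1-periodic subset of the line.
  Then \<open>b C\<^sub>x \<subseteq> C\<^sub>x\<close> and \<open>a C\<^sub>x \<subseteq> C\<^bsub>T\<^sub>a x\<^esub>\<close>. The key fact concerns any measurable family of closed sets \<open>F\<^sub>x\<close>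
  with these two properties: for almost every \<open>x\<close>, if \<open>F\<^sub>x\<close> accumulates at \<open>0\<close> from the right then \<open>F\<^sub>x\<close> is everything.
  Indeed, let \<open>A\<close> be the set of exceptional \<open>x\<close> for which \<open>F\<^sub>x\<close> misses a given interval, and let \<open>E\<close> be the
  Lebesgue null set of points whose \<open>T\<^sub>b\<close>-orbit misses it. A tiny \<open>y \<in> F\<^sub>x\<close> yields \<open>b\<^sup>l a\<^sup>m y \<in> E\<close> whenever
  \<open>T\<^sub>a\<^sup>m x \<in> A\<close>. Choosing times \<open>m\<^sub>i\<close> for which \<open>m\<^sub>i log a / log b\<close> is evenly spread modulo 1, this can happen only
  for a small proportion of the \<open>i\<close>, whereas by invariance the mean proportion is \<open>\<mu>(A)\<close>.

  If \<open>C\<^sub>x\<close> contains a rational \<open>p/d\<close>, then \<open>C\<^bsub>d x\<^esub>\<close> or \<open>C\<^bsub>-d x\<^esub>\<close> accumulates at \<open>0\<close>, and the key fact applies to it.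
  Otherwise fix \<open>q\<close> prime to \<open>a b\<close> and pass to powers of \<open>a\<close> and \<open>b\<close> that are 1 modulo \<open>q\<close>. The difference set
  of an invariant set of irrationals accumulates at \<open>0\<close>, so it is everything and contains \<open>1/q\<close>; hence
  \<open>F \<inter> (F + 1/q)\<close> is nonempty, and it is again an equivariant family. After \<open>q\<close> such steps \<open>C\<^sub>x\<close> contains a
  coset of the multiples of \<open>1/q\<close>. As \<open>q\<close> is arbitrarily large, \<open>C\<^sub>x\<close> is everything.
\<close>

section \<open>Closed sets invariant under multiplication by \<open>b\<close>\<close>

text \<open>Closed invariant subsets of the circle are encoded as 1-periodic subsets of the line, so
  that \<open>b\<close> acts linearly and differences and translates need no reduction modulo
  1.\<close>

definition invariant_set :: "int \<Rightarrow> real set \<Rightarrow> bool" where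
  "invariant_set b E \<longleftrightarrow> closed E \<and> (\<forall>z\<in>E. \<forall>k::int. z + of_int k \<in> E) \<and> (\<forall>z\<in>E. of_int b * z \<in> E)"

lemma invariant_setD:
  assumes "invariant_set b E"
  shows "closed E" "z \<in> E \<Longrightarrow> z + of_int k \<in> E" "z \<in> E \<Longrightarrow> z - of_int k \<in> E"
    "z \<in> E \<Longrightarrow> of_int b * z \<in> E" "z \<in> E \<Longrightarrow> of_int b ^ n * z \<in> E"
    "z \<in> E \<Longrightarrow> frac z \<in> E"
proof -
  have 1: "closed E" and 2: "\<And>z k. z \<in> E \<Longrightarrow> z + of_int k \<in> E" and 3: "\<And>z. z \<in> E \<Longrightarrow> of_int b * z \<in> E"
    using assms unfolding invariant_set_def by auto
  show "closed E" "z \<in> E \<Longrightarrow> z + of_int k \<in> E" "z \<in> E \<Longrightarrow> of_int b * z \<in> E"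
    using 1 2 3 by auto
  show 4: "z \<in> E \<Longrightarrow> z - of_int k \<in> E" for z k
    using 2[of z "-k"] by simp
  show "z \<in> E \<Longrightarrow> of_int b ^ n * z \<in> E"
    by (induction n) (auto simp: mult.assoc dest: 3)
  show "z \<in> E \<Longrightarrow> frac z \<in> E"
    unfolding frac_def by (rule 4)
qed

lemma invariant_set_power:
  assumes "invariant_set b E"
  shows "invariant_set (b ^ n) E"
  using invariant_setD[OF assms] unfolding invariant_set_def by simp

lemma adic_interval_in_open:
  fixes V :: "real set"
  assumes "open V" "v \<in> V" "(2::int) \<le> b"
  obtains n and j :: int where "{of_int j / of_int (b ^ n) .. (of_int j + 1) / of_int (b ^ n)} \<subseteq> V"
proof -
  obtain e where e: "e > 0" "ball v e \<subseteq> V"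
    using assms openE by blast
  obtain n where n: "(1 / real_of_int b) ^ n < e"
    using real_arch_pow_inv[of e "1 / real_of_int b"] assms e by auto
  define B where "B = real_of_int (b ^ n)"
  have B: "B > 0" "1 / B < e"
    using assms n unfolding B_def by (auto simp: power_one_over)
  define j where "j = \<lfloor>B * v\<rfloor>"
  have j: "of_int j \<le> B * v" "B * v < of_int j + 1"
    unfolding j_def by linarith+
  have "w \<in> V" if "w \<in> {of_int j / B .. (of_int j + 1) / B}" for w
  proof -
    have "of_int j \<le> B * w" "B * w \<le> of_int j + 1"
      using that B by (auto simp: field_simps)
    then have "\<bar>B * w - B * v\<bar> \<le> 1"
      using j by linarith
    moreover have "\<bar>B * w - B * v\<bar> = B * \<bar>w - v\<bar>"
      using B by (simp add: abs_mult flip: right_diff_distrib)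
    ultimately have "\<bar>w - v\<bar> \<le> 1 / B"
      using B by (simp add: field_simps)
    then show ?thesis
      using B e by (auto simp: dist_real_def ball_def subset_iff abs_minus_commute)
  qed
  then show ?thesis
    using that[of j n] unfolding B_def by (meson subsetI)
qed

lemma emeasure_lborel_affine_vimage:
  assumes [measurable]: "K \<in> sets borel" and "(c::real) > 0"
  shows "emeasure lborel K = c * emeasure lborel {x. t + c * x \<in> K}"
proof -
  have "emeasure lborel K = (\<integral>\<^sup>+x. indicator K x \<partial>lborel)"
    using assms by simp
  also have "\<dots> = c * (\<integral>\<^sup>+x. indicator K (t + c * x) \<partial>lborel)"
    using nn_integral_real_affine[of "indicator K" c t] assms by simp
  also have "(\<integral>\<^sup>+x. indicator K (t + c * x) \<partial>lborel) = (\<integral>\<^sup>+x. indicator {x. t + c * x \<in> K} x \<partial>lborel)"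
    by (intro nn_integral_cong) (auto simp: indicator_def)
  also have "\<dots> = emeasure lborel {x. t + c * x \<in> K}"
    using assms by (intro nn_integral_indicator) measurable
  finally show ?thesis .
qed

text \<open>\<open>E \<inter> [0,1)\<close> is covered by \<open>b\<^sup>n - 1\<close> copies of itself, each scaled by \<open>b\<^sup>-\<^sup>n\<close>.\<close>

lemma invariant_set_null:
  assumes E: "invariant_set b E" and b: "b \<ge> 2" and ne: "E \<noteq> UNIV"
  shows "negligible E"
proof -
  note ED = invariant_setD[OF E]
  have "open (-E)" using ED(1) by auto
  obtain v where "v \<in> -E" using ne by auto
  obtain n j where nj: "{of_int j / of_int (b ^ n) .. (of_int j + 1) / of_int (b ^ n)} \<subseteq> -E"
    using adic_interval_in_open[OF \<open>open (-E)\<close> \<open>v \<in> -E\<close> b] by blast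
  define B where "B = b ^ n"
  have B: "B > 0" using b unfolding B_def by auto
  \<comment> \<open>Periodicity moves the missed interval into [0,1), where it is the cell with
    index \<open>j'\<close>; only the other \<open>B - 1\<close> cells can meet
    \<open>E\<close>.\<close>
  define j' where "j' = j mod B"
  define K where "K = E \<inter> {0..<1}"
  define m where "m = measure lborel K"
  define I where "I = {0..<B} - {j'}"
  have j': "j' \<in> {0..<B}" using B unfolding j'_def by auto
  have Kb[measurable]: "K \<in> sets borel"
    unfolding K_def using ED(1) by auto
  have "emeasure lborel K \<le> emeasure lborel {0..<1::real}"
    unfolding K_def using ED(1) by (intro emeasure_mono) auto
  then have fin: "emeasure lborel K < \<infinity>"
    by (simp add: order_le_less_trans)
  define P where "P i = {x. - real_of_int i + real_of_int B * x \<in> K}" for i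
  have Pb: "P i \<in> sets borel" for i
    unfolding P_def by measurable
  have eP: "emeasure lborel K = real_of_int B * emeasure lborel (P i)" for i
    unfolding P_def using emeasure_lborel_affine_vimage[OF Kb, of "real_of_int B" "- real_of_int i"] B by simp
  have finP: "emeasure lborel (P i) < \<infinity>" for i
  proof (rule ccontr)
    assume "\<not> emeasure lborel (P i) < \<infinity>"
    then have "emeasure lborel (P i) = Orderings.top" by (metis infinity_ennreal_def less_top)
    then have "emeasure lborel K = Orderings.top"
      using eP[of i] B by (simp add: ennreal_mult_eq_top_iff)
    then show False using fin by simp
  qed
  have mP: "measure lborel (P i) = m / real_of_int B" for i
  proof -
    have "m = real_of_int B * measure lborel (P i)"
      unfolding m_def measure_def using eP[of i] B by (simp add: enn2real_mult)
    then show ?thesis using B by (simp add: field_simps)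
  qed
  have cover: "K \<subseteq> (\<Union>i\<in>I. P i)"
  proof
    fix z assume z: "z \<in> K"
    define i where "i = \<lfloor>of_int B * z\<rfloor>"
    have "i \<in> {0..<B}"
      using z B unfolding i_def K_def by (auto simp: floor_less_iff)
    moreover have "i \<noteq> j'"
    proof
      assume "i = j'"
      define k where "k = j div B"
      have "j = B * k + i"
        unfolding k_def \<open>i = j'\<close> j'_def by simp
      then have jr: "real_of_int j = of_int B * of_int k + of_int i"
        by simp
      have "of_int i \<le> of_int B * z" "of_int B * z < of_int i + 1"
        unfolding i_def by linarith+
      then have "z + of_int k \<in> {of_int j / of_int B .. (of_int j + 1) / of_int B}"
        using B unfolding jr by (auto simp: field_simps)
      then have "z + of_int k \<notin> E" using nj unfolding B_def by auto
      then show False using ED(2) z unfolding K_def by auto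
    qed
    moreover have "frac (of_int B * z) \<in> E"
      using ED(5,6) z unfolding B_def K_def by auto
    then have "z \<in> P i"
      unfolding P_def i_def K_def frac_def using frac_lt_1[of "of_int B * z"] frac_ge_0[of "of_int B * z"]
      by (auto simp: frac_def)
    ultimately show "z \<in> (\<Union>i\<in>I. P i)" unfolding I_def by auto
  qed
  have cI: "card I = nat (B - 1)"
    using j' B by (simp add: I_def nat_diff_distrib)
  have "P i \<in> fmeasurable lborel" for i
    using Pb finP by (intro fmeasurableI) auto
  then have UPf: "(\<Union>i\<in>I. P i) \<in> fmeasurable lborel"
    by (intro fmeasurable.finite_UN) (auto simp: I_def)
  have "m \<le> measure lborel (\<Union>i\<in>I. P i)"
    unfolding m_def
    by (rule measure_mono_fmeasurable[OF cover]) (use Kb UPf in auto)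
  also have "\<dots> \<le> (\<Sum>i\<in>I. measure lborel (P i))"
    by (rule measure_UNION_le) (use Pb in \<open>auto simp: I_def\<close>)
  also have "\<dots> = real_of_int (B - 1) * (m / real_of_int B)"
    using B cI by (simp add: mP)
  \<comment> \<open>Only \<open>B - 1\<close> pieces of measure m / B are available, so m <= (1 -
    1/B) m, which forces m = 0.\<close>
  finally have "m \<le> m - m / real_of_int B"
    using B by (simp add: field_simps)
  then have "m \<le> 0" using B by (simp add: field_simps)
  then have "m = 0" unfolding m_def by (simp add: measure_le_0_iff)
  then have "emeasure lborel K = 0"
    using fin unfolding m_def by (auto simp: measure_def enn2real_eq_0_iff)
  then have "K \<in> null_sets lborel"
    using Kb by auto
  then have nK: "negligible K"
    unfolding negligible_iff_null_sets by (rule null_sets_completionI)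
  have "E \<subseteq> (\<Union>k\<in>range real_of_int. (+) k ` K)"
  proof
    fix z assume "z \<in> E"
    then have "frac z \<in> K"
      using ED(6) frac_lt_1 frac_ge_0 unfolding K_def by auto
    moreover have "z = of_int \<lfloor>z\<rfloor> + frac z" unfolding frac_def by simp
    ultimately show "z \<in> (\<Union>k\<in>range real_of_int. (+) k ` K)" by blast
  qed
  moreover have "negligible (\<Union>k\<in>range real_of_int. (+) k ` K)"
    using negligible_translation[OF nK]
    by (intro negligible_countable_Union) auto
  ultimately show ?thesis using negligible_subset by blast
qed

section \<open>Rotations and null sets\<close>

text \<open>In the coordinate log_b, multiplication by \<open>b\<close> is translation by 1, and the
  logarithm, being differentiable, keeps null sets null. The range [0,2] contains every sum of two
  fractional parts; its compactness later gives uniform neighbourhoods.\<close>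

lemma compact_negligible_powr_vimage:
  fixes E :: "real set"
  assumes "closed E" "negligible E" "b > 1"
  shows "compact {u \<in> {0..2}. b powr u \<in> E}" "negligible {u \<in> {0..2}. b powr u \<in> E}"
proof -
  have "closed ((\<lambda>u. b powr u) -` E)"
    by (rule closed_vimage[OF assms(1)]) (use assms(3) in \<open>auto intro!: continuous_intros\<close>)
  then have "compact ({0..2} \<inter> (\<lambda>u. b powr u) -` E)"
    by (intro compact_Int_closed) auto
  also have "{0..2} \<inter> (\<lambda>u. b powr u) -` E = {u \<in> {0..2}. b powr u \<in> E}" by auto
  finally show "compact {u \<in> {0..2}. b powr u \<in> E}" .
  have "log b differentiable_on (E \<inter> {0<..})"
    unfolding differentiable_on_def
    by (metis DERIV_log Int_iff differentiable_at_withinI greaterThan_iff real_differentiable_def)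
  then have "negligible (log b ` (E \<inter> {0<..}))"
    by (intro negligible_differentiable_image_negligible) (auto intro: negligible_subset[OF assms(2)])
  moreover have "{u \<in> {0..2}. b powr u \<in> E} \<subseteq> log b ` (E \<inter> {0<..})"
  proof
    fix u assume "u \<in> {u \<in> {0..2}. b powr u \<in> E}"
    then show "u \<in> log b ` (E \<inter> {0<..})"
      using assms(3) by (intro image_eqI[of _ _ "b powr u"]) auto
  qed
  ultimately show "negligible {u \<in> {0..2}. b powr u \<in> E}" by (rule negligible_subset)
qed

text \<open>The times \<open>m i\<close> are chosen with \<open>frac (m i * \<alpha>) \<approx> i / M\<close>. Visits to \<open>E\<close> then give disjoint
  intervals of length \<open>1 / M\<close> close to a compact null set, uniformly in the starting point \<open>\<theta>\<close>.\<close>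

lemma rotation_rarely_visits_null_set:
  fixes E :: "real set"
  assumes E: "closed E" "negligible E" and b: "b > 1" and \<alpha>: "\<alpha> \<notin> \<rat>" and c: "c > 0"
  obtains M :: nat and m :: "nat \<Rightarrow> nat" where "M > 0"
    "\<And>\<theta>. \<theta> \<in> {0..<1} \<Longrightarrow> real (card {i. i < M \<and> b powr (\<theta> + frac (real (m i) * \<alpha>)) \<in> E}) \<le> c * real M"
proof -
  define N where "N = {u \<in> {0..2}. b powr u \<in> E}"
  have N: "compact N" "negligible N"
    unfolding N_def using compact_negligible_powr_vimage[OF E b] by auto
  have N0: "N \<in> null_sets lebesgue" using N(2) by (simp add: negligible_iff_null_sets)
  then have "N \<in> sets lebesgue" by auto
  then obtain U where U: "open U" "N \<subseteq> U" "emeasure lebesgue (U - N) < ennreal c"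
    by (rule sets_lebesgue_outer_open[OF _ c])
  have Us: "U \<in> sets lebesgue" using U(1) by auto
  have eU: "emeasure lebesgue U < ennreal c"
    using emeasure_Diff_null_set[OF N0 Us] U(3) by simp
  obtain \<epsilon> where \<epsilon>: "\<epsilon> > 0" "(\<Union>x\<in>N. ball x \<epsilon>) \<subseteq> U"
    using compact_subset_open_imp_ball_epsilon_subset[OF N(1) U(1,2)] by blast
  obtain M where M: "M > 0" "1 / real M < \<epsilon>"
    by (metis \<epsilon>(1) gr_zeroI inverse_eq_divide real_arch_inverse)
  have near: "x - h < f \<and> f < x + h" if "\<bar>f - x\<bar> < h" for f x h :: real
    using that by linarith
  \<comment> \<open>Kronecker's theorem, aimed at the midpoint of the \<open>i\<close>-th of
    \<open>M\<close> equal cells with tolerance half a cell.\<close>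
  have "\<exists>n. real i / M < frac (real n * \<alpha>) \<and> frac (real n * \<alpha>) < (real i + 1) / M" if "i < M" for i
  proof -
    have "(real i + 1/2) / M \<le> 1" "0 < 1 / (2 * real M)"
      using that M by (auto simp: field_simps)
    then obtain k where k: "\<bar>frac (real k * \<alpha>) - (real i + 1/2) / M\<bar> < 1 / (2 * real M)"
      using Kronecker_approx_1_explicit[OF \<alpha>, of "(real i + 1/2) / M" "1 / (2 * real M)"] by auto
    have "real i / M = (real i + 1/2) / M - 1 / (2 * real M)"
      "(real i + 1) / M = (real i + 1/2) / M + 1 / (2 * real M)"
      using M by (auto simp: field_simps)
    moreover have "(real i + 1/2) / M - 1 / (2 * real M) < frac (real k * \<alpha>)"
      "frac (real k * \<alpha>) < (real i + 1/2) / M + 1 / (2 * real M)"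
      using near[OF k] by auto
    ultimately show ?thesis by metis
  qed
  then obtain m where m: "\<And>i. i < M \<Longrightarrow> real i / M < frac (real (m i) * \<alpha>) \<and> frac (real (m i) * \<alpha>) < (real i + 1) / M"
    by metis
  have "real (card {i. i < M \<and> b powr (\<theta> + frac (real (m i) * \<alpha>)) \<in> E}) \<le> c * real M" if \<theta>: "\<theta> \<in> {0..<1}" for \<theta>
  proof -
    define I where "I = {i. i < M \<and> b powr (\<theta> + frac (real (m i) * \<alpha>)) \<in> E}"
    have fI: "finite I" unfolding I_def by auto
    define J where "J i = {\<theta> + real i / M <..< \<theta> + (real i + 1) / M}" for i
    have Js: "J i \<in> sets lebesgue" for i unfolding J_def by simp
    have JU: "J i \<subseteq> U" if i: "i \<in> I" for i
    proof -
      define u where "u = \<theta> + frac (real (m i) * \<alpha>)"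
      have "u \<in> N"
        using i \<theta> frac_lt_1[of "real (m i) * \<alpha>"] frac_ge_0[of "real (m i) * \<alpha>"]
        unfolding N_def I_def u_def by auto
      \<comment> \<open>Both \<open>u\<close> and the points of \<open>J i\<close> lie in one
        interval of length 1/M, which is below \<epsilon>.\<close>
      moreover have "J i \<subseteq> ball u \<epsilon>"
      proof
        fix w assume "w \<in> J i"
        moreover have "(real i + 1) / M = real i / M + 1 / M" by (simp add: add_divide_distrib)
        ultimately have "\<bar>u - w\<bar> < 1 / M"
          using m[of i] i unfolding I_def J_def u_def by (auto simp: abs_less_iff)
        then show "w \<in> ball u \<epsilon>" using M by (simp add: dist_real_def)
      qed
      ultimately show ?thesis using \<epsilon> by blast
    qed
    have "disjoint_family_on J I"
    proof -
      have "J i \<inter> J j = {}" if "i < j" for i j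
      proof -
        have "(real i + 1) / M \<le> real j / M"
          using that by (intro divide_right_mono) auto
        then show ?thesis unfolding J_def by auto
      qed
      then show ?thesis
        unfolding disjoint_family_on_def by (metis inf_commute linorder_neqE_nat)
    qed
    then have "emeasure lebesgue (\<Union>i\<in>I. J i) = (\<Sum>i\<in>I. emeasure lebesgue (J i))"
      using fI Js by (intro sum_emeasure[symmetric]) auto
    also have "\<dots> = (\<Sum>i\<in>I. ennreal (1 / M))"
      using M by (intro sum.cong) (auto simp: J_def add_divide_distrib)
    also have "\<dots> = ennreal (card I / M)"
      by (subst sum_ennreal) auto
    finally have "ennreal (card I / M) \<le> emeasure lebesgue U"
      using JU Us by (metis UN_least emeasure_mono)
    also have "\<dots> < ennreal c" by (rule eU)
    finally have "card I / M \<le> c" using c by (simp add: ennreal_less_iff)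
    then show ?thesis using M unfolding I_def by (simp add: field_simps)
  qed
  then show ?thesis using that M by blast
qed

section \<open>Equivariant families that accumulate at zero\<close>

lemma invariant_under_funpow:
  assumes "invariant_under \<mu> T"
  shows "invariant_under \<mu> (T ^^ n)"
proof (induction n)
  case 0
  then show ?case
    by (auto simp: invariant_under_def sets.Int_space_eq2)
next
  case (Suc n)
  have T: "T \<in> measurable \<mu> \<mu>" "\<And>A. A \<in> sets \<mu> \<Longrightarrow> emeasure \<mu> (T -` A \<inter> space \<mu>) = emeasure \<mu> A"
    using assms by (auto simp: invariant_under_def)
  have Tn: "T ^^ n \<in> measurable \<mu> \<mu>" "\<And>A. A \<in> sets \<mu> \<Longrightarrow> emeasure \<mu> ((T ^^ n) -` A \<inter> space \<mu>) = emeasure \<mu> A"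
    using Suc by (auto simp: invariant_under_def)
  have "emeasure \<mu> ((T ^^ Suc n) -` A \<inter> space \<mu>) = emeasure \<mu> A" if A: "A \<in> sets \<mu>" for A
  proof -
    have "(T ^^ Suc n) -` A \<inter> space \<mu> = (T ^^ n) -` (T -` A \<inter> space \<mu>) \<inter> space \<mu>"
      using measurable_space[OF Tn(1)] by auto
    then show ?thesis
      using T(2)[OF A] Tn(2)[of "T -` A \<inter> space \<mu>"] measurable_sets[OF T(1) A] by simp
  qed
  moreover have "T ^^ Suc n \<in> measurable \<mu> \<mu>"
    using measurable_comp[OF Tn(1) T(1)] by simp
  ultimately show ?case unfolding invariant_under_def by blast
qed

text \<open>Integrate the number of visits: by invariance each of the \<open>M\<close> indicators
  has the measure of \<open>A\<close> as its integral, whatever the times \<open>m i\<close>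
  are.\<close>

lemma measure_le_visit_frequency:
  fixes m :: "nat \<Rightarrow> nat"
  assumes "prob_space \<mu>" "invariant_under \<mu> T" and A[measurable]: "A \<in> sets \<mu>" and "M > 0"
    and le: "\<And>x. x \<in> space \<mu> \<Longrightarrow> real (card {i. i < M \<and> (T ^^ m i) x \<in> A}) \<le> c * real M"
  shows "measure \<mu> A \<le> c"
proof -
  interpret prob_space \<mu> by fact
  define f where "f i = (\<lambda>x. indicat_real ((T ^^ m i) -` A \<inter> space \<mu>) x)" for i
  have inv: "(T ^^ m i) -` A \<inter> space \<mu> \<in> sets \<mu>" "measure \<mu> ((T ^^ m i) -` A \<inter> space \<mu>) = measure \<mu> A" for i
    using invariant_under_funpow[OF assms(2), of "m i"] A
    by (auto simp: invariant_under_def measure_def)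
  have int: "integrable \<mu> (f i)" for i
    unfolding f_def using inv(1) by (intro integrable_real_indicator) (auto simp: less_top[symmetric])
  have "real M * measure \<mu> A = (\<Sum>i<M. \<integral>x. f i x \<partial>\<mu>)"
    unfolding f_def using inv by simp
  also have "\<dots> = (\<integral>x. (\<Sum>i<M. f i x) \<partial>\<mu>)"
    using int by (subst Bochner_Integration.integral_sum) auto
  also have "\<dots> \<le> (\<integral>x. c * real M \<partial>\<mu>)"
  proof (rule integral_mono)
    fix x assume x: "x \<in> space \<mu>"
    have "(\<Sum>i<M. f i x) = (\<Sum>i\<in>{i \<in> {..<M}. (T ^^ m i) x \<in> A}. 1)"
      unfolding sum.inter_filter[OF finite_lessThan] using x by (intro sum.cong) (auto simp: f_def)
    also have "\<dots> = real (card {i. i < M \<and> (T ^^ m i) x \<in> A})"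
      by (simp add: lessThan_def)
    finally show "(\<Sum>i<M. f i x) \<le> c * real M" using le[OF x] by simp
  qed (use int in auto)
  also have "\<dots> = c * real M" by (simp add: prob_space)
  finally show ?thesis using assms(4) by simp
qed

text \<open>These are random closed sets. Measurability is expressed through hits of compact
  intervals, a form that passes to difference sets and to intersections with translates.\<close>

definition equivariant_family :: "real measure \<Rightarrow> (real \<Rightarrow> real) \<Rightarrow> int \<Rightarrow> int \<Rightarrow> (real \<Rightarrow> real set) \<Rightarrow> bool" where
  "equivariant_family \<mu> T a b F \<longleftrightarrow>
     (\<forall>x\<in>space \<mu>. invariant_set b (F x) \<and> (\<forall>z\<in>F x. of_int a * z \<in> F (T x))) \<and>
     (\<forall>c d. {x \<in> space \<mu>. F x \<inter> {c..d} \<noteq> {}} \<in> sets \<mu>)"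

text \<open>One-sided because logarithms of the small points are taken; approach from the left is
  handled by changing the sign of the multiplier in \<open>orbit_closure\<close>.\<close>

definition accumulates_at_zero :: "real set \<Rightarrow> bool" where
  "accumulates_at_zero E \<longleftrightarrow> (\<forall>\<epsilon>>0. \<exists>y\<in>E. 0 < y \<and> y < \<epsilon>)"

lemma equivariant_familyD:
  assumes "equivariant_family \<mu> T a b F"
  shows "x \<in> space \<mu> \<Longrightarrow> invariant_set b (F x)"
    "x \<in> space \<mu> \<Longrightarrow> z \<in> F x \<Longrightarrow> of_int a * z \<in> F (T x)"
    "{x \<in> space \<mu>. F x \<inter> {c..d} \<noteq> {}} \<in> sets \<mu>"
  using assms unfolding equivariant_family_def by auto

lemma equivariant_family_funpow:
  assumes F: "equivariant_family \<mu> T a b F" and T: "T \<in> measurable \<mu> \<mu>" and x: "x \<in> space \<mu>"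
  shows "z \<in> F x \<Longrightarrow> of_int a ^ n * z \<in> F ((T ^^ n) x)" "(T ^^ n) x \<in> space \<mu>"
proof -
  show *: "(T ^^ n) x \<in> space \<mu>" for n
    using x by (induction n) (auto dest: measurable_space[OF T])
  show "z \<in> F x \<Longrightarrow> of_int a ^ n * z \<in> F ((T ^^ n) x)"
    by (induction n) (auto simp: mult.assoc intro: equivariant_familyD(2)[OF F *])
qed

lemma equivariant_family_power:
  assumes F: "equivariant_family \<mu> T a b F" and T: "T \<in> measurable \<mu> \<mu>"
  shows "equivariant_family \<mu> (T ^^ n) (a ^ n) (b ^ n) F"
  using equivariant_familyD[OF F] equivariant_family_funpow[OF F T] invariant_set_power
  unfolding equivariant_family_def by auto

text \<open>Bounding the small points away from 0 as well leaves countably many hits of compact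
  intervals, which are measurable events for an equivariant family.\<close>

lemma accumulates_at_zero_iff:
  "accumulates_at_zero E \<longleftrightarrow> (\<forall>j::nat. \<exists>i::nat. E \<inter> {1 / real (Suc i)..1 / real (Suc j)} \<noteq> {})"
proof
  assume E: "accumulates_at_zero E"
  show "\<forall>j::nat. \<exists>i::nat. E \<inter> {1 / real (Suc i)..1 / real (Suc j)} \<noteq> {}"
  proof
    fix j :: nat
    obtain y where y: "y \<in> E" "0 < y" "y < 1 / real (Suc j)"
      using E unfolding accumulates_at_zero_def by (metis of_nat_0_less_iff zero_less_Suc zero_less_divide_1_iff)
    obtain i where "1 / real (Suc i) < y"
      using y(2) nat_approx_posE by blast
    then show "\<exists>i::nat. E \<inter> {1 / real (Suc i)..1 / real (Suc j)} \<noteq> {}"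
      using y by (intro exI[of _ i]) auto
  qed
next
  assume E: "\<forall>j::nat. \<exists>i::nat. E \<inter> {1 / real (Suc i)..1 / real (Suc j)} \<noteq> {}"
  show "accumulates_at_zero E"
    unfolding accumulates_at_zero_def
  proof (intro allI impI)
    fix \<epsilon> :: real assume "\<epsilon> > 0"
    then obtain j where j: "1 / real (Suc j) < \<epsilon>" using nat_approx_posE by blast
    then obtain i y where y: "y \<in> E" "1 / real (Suc i) \<le> y" "y \<le> 1 / real (Suc j)"
      using E by fastforce
    have "0 < 1 / real (Suc i)" by simp
    then show "\<exists>y\<in>E. 0 < y \<and> y < \<epsilon>"
      using y j by (meson le_less_trans less_le_trans)
  qed
qed

lemma sets_accumulates_at_zero:
  assumes F: "equivariant_family \<mu> T a b F"
  shows "{x \<in> space \<mu>. accumulates_at_zero (F x)} \<in> sets \<mu>"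
  unfolding accumulates_at_zero_iff
  using equivariant_familyD(3)[OF F] by measurable

section \<open>The irrational angle and the exceptional null set\<close>

lemma log_irrational:
  assumes a: "(a::int) \<ge> 2" and b: "b \<ge> 2" and ind: "multiplicatively_independent a b"
  shows "log b a \<notin> \<rat>"
proof
  assume "log b a \<in> \<rat>"
  moreover have pos: "log b a > 0" using a b by simp
  ultimately obtain p q :: nat where pq: "q \<noteq> 0" "log b a = real p / real q"
    using Rats_abs_nat_div_natE by (metis abs_of_pos)
  then have "p > 0" using pos by (cases p) auto
  have "log b (real_of_int a ^ q) = log b (real_of_int b ^ p)"
    using pq a b by (simp add: log_nat_power)
  then have "real_of_int a ^ q = real_of_int b ^ p"
    using a b log_inj[of "real_of_int b"] by (simp add: inj_on_def)
  then have "a ^ q = b ^ p"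
    by (metis of_int_eq_iff of_int_power)
  then show False
    using ind pq(1) \<open>p > 0\<close> unfolding multiplicatively_independent_def by auto
qed

lemma multiplicatively_independent_power:
  assumes "multiplicatively_independent a b" "k > 0"
  shows "multiplicatively_independent (a ^ k) (b ^ k)"
  using assms unfolding multiplicatively_independent_def
  by (metis nat_0_less_mult_iff power_mult)

text \<open>Together with \<open>invariant_set_subset_avoiding\<close>, this is the largest
  invariant set disjoint from \<open>V\<close>. It does not depend on x, so one set controls all
  fibres that miss \<open>V\<close>.\<close>

lemma invariant_set_avoiding:
  assumes "open V"
  shows "invariant_set b {z. \<forall>n::nat. \<forall>k::int. of_int b ^ n * z + of_int k \<notin> V}" (is "invariant_set b ?E")
  unfolding invariant_set_def
proof (intro conjI ballI allI)
  have "closed ((\<lambda>z. of_int b ^ n * z + of_int k) -` (- V))" for n and k :: int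
    using assms by (intro closed_vimage continuous_intros) auto
  then have "closed (\<Inter>n. \<Inter>k. (\<lambda>z. of_int b ^ n * z + of_int k) -` (- V))"
    by (intro closed_INT ballI)
  also have "(\<Inter>n. \<Inter>k. (\<lambda>z. of_int b ^ n * z + of_int k) -` (- V)) = ?E" by auto
  finally show "closed ?E" .
next
  fix z and k :: int assume "z \<in> ?E"
  then have z: "of_int b ^ n * z + of_int l \<notin> V" for n l by blast
  show "z + of_int k \<in> ?E"
  proof (intro CollectI allI)
    fix n :: nat and l :: int
    have "of_int b ^ n * (z + of_int k) + of_int l = of_int b ^ n * z + of_int (b ^ n * k + l)"
      by (simp add: algebra_simps)
    then show "of_int b ^ n * (z + of_int k) + of_int l \<notin> V" using z by (simp only: not_False_eq_True)
  qed
next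
  fix z assume "z \<in> ?E"
  then have z: "of_int b ^ n * z + of_int l \<notin> V" for n l by blast
  show "of_int b * z \<in> ?E"
  proof (intro CollectI allI)
    fix n :: nat and l :: int
    have "of_int b ^ n * (of_int b * z) + of_int l = of_int b ^ Suc n * z + of_int l"
      by (simp add: algebra_simps)
    then show "of_int b ^ n * (of_int b * z) + of_int l \<notin> V" using z by (simp only: not_False_eq_True)
  qed
qed

lemma invariant_set_subset_avoiding:
  assumes "invariant_set b E" "E \<inter> V = {}"
  shows "E \<subseteq> {z. \<forall>n::nat. \<forall>k::int. of_int b ^ n * z + of_int k \<notin> V}"
proof (intro subsetI CollectI allI)
  fix z n and k :: int assume "z \<in> E"
  then have "of_int b ^ n * z + of_int k \<in> E"
    using invariant_setD[OF assms(1)] by blast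
  then show "of_int b ^ n * z + of_int k \<notin> V" using assms(2) by auto
qed

text \<open>The order of choices matters: \<open>M\<close> and the times \<open>m i\<close> depend
  only on \<open>c\<close>, the angle and the null set \<open>E\<close>, and the tiny point
  \<open>y\<close> is chosen afterwards, depending on x. This works because the visit count is
  uniform in the phase \<theta>.\<close>

lemma AE_meets_interval_if_accumulates:
  assumes pr: "prob_space \<mu>" and inv: "invariant_under \<mu> T"
    and a: "a \<ge> 2" and b: "b \<ge> 2" and ind: "multiplicatively_independent a b"
    and F: "equivariant_family \<mu> T a b F" and pq: "(p::real) < q"
  shows "AE x in \<mu>. accumulates_at_zero (F x) \<longrightarrow> F x \<inter> {p..q} \<noteq> {}"
proof -
  interpret prob_space \<mu> by fact
  have T: "T \<in> measurable \<mu> \<mu>" using inv unfolding invariant_under_def by auto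
  define A where "A = {x \<in> space \<mu>. accumulates_at_zero (F x)} - {x \<in> space \<mu>. F x \<inter> {p..q} \<noteq> {}}"
  have As: "A \<in> sets \<mu>"
    unfolding A_def using sets_accumulates_at_zero[OF F] equivariant_familyD(3)[OF F] by auto
  define E where "E = {z. \<forall>n::nat. \<forall>k::int. of_int b ^ n * z + of_int k \<notin> {p<..<q}}"
  have E: "invariant_set b E" unfolding E_def by (rule invariant_set_avoiding) auto
  have "(p + q) / 2 \<notin> E"
    using pq unfolding E_def by (auto intro!: exI[of _ "0::nat"] exI[of _ "0::int"])
  then have En: "negligible E" using invariant_set_null[OF E b] by auto
  have FE: "F x \<subseteq> E" if "x \<in> A" for x
    unfolding E_def using that equivariant_familyD(1)[OF F]
    by (intro invariant_set_subset_avoiding) (auto simp: A_def)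
  define \<alpha> where "\<alpha> = log b a"
  have \<alpha>: "\<alpha> \<notin> \<rat>" unfolding \<alpha>_def by (rule log_irrational[OF a b ind])
  have le: "measure \<mu> A \<le> c" if "c > 0" for c
  proof -
    have b1: "real_of_int b > 1" using b by simp
    obtain M :: nat and m :: "nat \<Rightarrow> nat" where M: "M > 0" and
      count: "\<And>\<theta>. \<theta> \<in> {0..<1} \<Longrightarrow> real (card {i. i < M \<and> b powr (\<theta> + frac (real (m i) * \<alpha>)) \<in> E}) \<le> c * real M"
      using rotation_rarely_visits_null_set[OF invariant_setD(1)[OF E] En b1 \<alpha> \<open>c > 0\<close>] by blast
    have "real (card {i. i < M \<and> (T ^^ m i) x \<in> A}) \<le> c * real M" if x: "x \<in> space \<mu>" for x
    proof (cases "{i. i < M \<and> (T ^^ m i) x \<in> A} = {}")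
      case True
      then show ?thesis using \<open>c > 0\<close> by (simp only: card.empty) simp
    next
      case False
      define I where "I = {i. i < M \<and> (T ^^ m i) x \<in> A}"
      have fI: "finite I" "I \<noteq> {}" using False unfolding I_def by auto
      \<comment> \<open>A fibre is known to accumulate at 0 only at visits to \<open>A\<close>, so
        the argument starts from the earliest listed visit.\<close>
      obtain i0 where i0: "i0 \<in> I" "\<And>i. i \<in> I \<Longrightarrow> m i0 \<le> m i"
        using ex_min_if_finite[of "m ` I"] fI by (metis arg_min_if_finite(1) arg_min_least)
      define L where "L = Max (m ` I)"
      have L: "m i \<le> L" if "i \<in> I" for i unfolding L_def using that fI by auto
      define x0 where "x0 = (T ^^ m i0) x"
      have "x0 \<in> A" using i0 unfolding x0_def I_def by auto
      then have x0: "x0 \<in> space \<mu>" "accumulates_at_zero (F x0)" unfolding A_def by auto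
      have aL: "real_of_int a ^ L > 0" using a by simp
      \<comment> \<open>So small that its product with any power of \<open>a\<close> up to the last
        visit stays below 1.\<close>
      then obtain y where y: "y \<in> F x0" "0 < y" "y < 1 / real_of_int a ^ L"
        using x0(2) unfolding accumulates_at_zero_def by (meson zero_less_divide_1_iff)
      \<comment> \<open>A fictitious value at time 0, which would become
        \<open>of_int a ^ m i * w\<close> at time \<open>m i\<close>; it need not lie in the fibre
        over \<open>x\<close>.\<close>
      define w where "w = y / real_of_int a ^ m i0"
      have w: "w > 0" unfolding w_def using y a by simp
      define \<theta> where "\<theta> = frac (log b w)"
      have "b powr (\<theta> + frac (real (m i) * \<alpha>)) \<in> E" if i: "i \<in> I" for i
      proof -
        define d where "d = m i - m i0"
        have d: "m i = m i0 + d" "d \<le> L" using i0(2)[OF i] L[OF i] unfolding d_def by auto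
        have z: "of_int a ^ d * y \<in> F ((T ^^ m i) x)"
          using equivariant_family_funpow(1)[OF F T x0(1) y(1), of d]
          unfolding x0_def d(1) by (metis add.commute comp_apply funpow_add)
        have zA: "(T ^^ m i) x \<in> A" using i unfolding I_def by auto
        have eq: "of_int a ^ d * y = of_int a ^ m i * w"
          unfolding w_def d(1) using a by (simp add: power_add)
        have "real_of_int a ^ d \<le> real_of_int a ^ L"
          using a d by (intro power_increasing) auto
        then have "of_int a ^ d * y < 1"
          using y aL by (smt (verit, best) mult_right_mono pos_less_divide_eq mult.commute)
        then have "log b (of_int a ^ m i * w) < 0"
          unfolding eq using b w a by simp
        moreover have lg: "log b (of_int a ^ m i * w) = real (m i) * \<alpha> + log b w"
          using a b w unfolding \<alpha>_def by (simp add: log_mult log_nat_power)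
        ultimately have "real (m i) * \<alpha> + log b w < 0" by simp
        then have "of_int (\<lfloor>real (m i) * \<alpha>\<rfloor> + \<lfloor>log b w\<rfloor>) \<le> (0::real)"
          by linarith
        then have fl: "\<lfloor>real (m i) * \<alpha>\<rfloor> + \<lfloor>log b w\<rfloor> \<le> 0" by simp
        \<comment> \<open>The number of multiplications by \<open>b\<close> that brings the point
          into [1, b^2); it is nonnegative because the point is below 1. The exponent becomes a sum
          of two fractional parts, with a phase \<theta> independent of \<open>i\<close>.\<close>
        define l where "l = nat (- (\<lfloor>real (m i) * \<alpha>\<rfloor> + \<lfloor>log b w\<rfloor>))"
        have l: "real l = - (of_int \<lfloor>real (m i) * \<alpha>\<rfloor> + of_int \<lfloor>log b w\<rfloor>)"
          unfolding l_def using fl by simp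
        have "\<theta> + frac (real (m i) * \<alpha>) = real l + log b (of_int a ^ m i * w)"
          unfolding \<theta>_def frac_def lg l by simp
        also have "b powr \<dots> = b powr real l * b powr (log b (of_int a ^ m i * w))"
          by (rule powr_add)
        also have "\<dots> = of_int b ^ l * (of_int a ^ m i * w)"
          using a b w by (simp add: powr_realpow)
        finally have "b powr (\<theta> + frac (real (m i) * \<alpha>)) = of_int b ^ l * (of_int a ^ d * y)"
          unfolding eq .
        then show ?thesis using invariant_setD(5)[OF E] z FE[OF zA] by auto
      qed
      then have "I \<subseteq> {i. i < M \<and> b powr (\<theta> + frac (real (m i) * \<alpha>)) \<in> E}"
        unfolding I_def by auto
      then have "card I \<le> card {i. i < M \<and> b powr (\<theta> + frac (real (m i) * \<alpha>)) \<in> E}"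
        by (intro card_mono) auto
      moreover have "\<theta> \<in> {0..<1}" unfolding \<theta>_def using frac_lt_1 by auto
      ultimately show ?thesis using count[of \<theta>] unfolding I_def by linarith
    qed
    then show ?thesis using measure_le_visit_frequency[OF pr inv As M] by blast
  qed
  have "measure \<mu> A \<le> 0"
    by (rule field_le_epsilon) (use le in auto)
  then have "emeasure \<mu> A = 0"
    by (simp add: emeasure_eq_measure measure_le_0_iff)
  then have "A \<in> null_sets \<mu>" using As by auto
  then have "AE x in \<mu>. x \<notin> A" by (rule AE_not_in)
  then show ?thesis
    by (rule AE_mp) (auto simp: A_def intro!: AE_I2)
qed

text \<open>Rational endpoints leave a single null set; off it, an accumulating fibre is dense as
  well as closed.\<close>

theorem AE_UNIV_if_accumulates:
  assumes "prob_space \<mu>" and "invariant_under \<mu> T"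
    and "a \<ge> 2" and "b \<ge> 2" and "multiplicatively_independent a b"
    and F: "equivariant_family \<mu> T a b F"
  shows "AE x in \<mu>. accumulates_at_zero (F x) \<longrightarrow> F x = UNIV"
proof -
  have "AE x in \<mu>. \<forall>p\<in>\<rat>. \<forall>q\<in>\<rat>. p < q \<longrightarrow> accumulates_at_zero (F x) \<longrightarrow> F x \<inter> {p..q} \<noteq> {}"
    using AE_meets_interval_if_accumulates[OF assms]
    by (simp add: AE_ball_countable countable_rat)
  then show ?thesis
  proof (rule AE_mp, intro AE_I2 impI)
    fix x assume x: "x \<in> space \<mu>" "accumulates_at_zero (F x)"
      and meets: "\<forall>p\<in>\<rat>. \<forall>q\<in>\<rat>. p < q \<longrightarrow> accumulates_at_zero (F x) \<longrightarrow> F x \<inter> {p..q} \<noteq> {}"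
    have "z \<in> F x" for z
    proof -
      have "\<exists>y\<in>F x. dist y z < \<epsilon>" if "\<epsilon> > 0" for \<epsilon>
      proof -
        obtain p where p: "p \<in> \<rat>" "z - \<epsilon> < p" "p < z" using Rats_dense_in_real[of "z - \<epsilon>" z] \<open>\<epsilon> > 0\<close> by auto
        obtain q where q: "q \<in> \<rat>" "z < q" "q < z + \<epsilon>" using Rats_dense_in_real[of z "z + \<epsilon>"] \<open>\<epsilon> > 0\<close> by auto
        obtain y where "y \<in> F x" "p \<le> y" "y \<le> q" using meets x(2) p q by fastforce
        then show ?thesis using p q by (intro bexI[of _ y]) (auto simp: dist_real_def)
      qed
      then have "z \<in> closure (F x)" by (simp add: closure_approachable)
      then show ?thesis using invariant_setD(1)[OF equivariant_familyD(1)[OF F x(1)]] by simp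
    qed
    then show "F x = UNIV" by auto
  qed
qed

section \<open>Constructions of equivariant families\<close>

definition diff_set :: "real set \<Rightarrow> real set" where
  "diff_set G = {z. \<exists>u\<in>G. \<exists>v\<in>G. z = u - v}"

text \<open>The multiplier \<open>d\<close>, possibly negative, serves to move a rational limit
  point to 0 and to choose the side of approach. The integers \<open>k\<close> make the set
  periodic.\<close>

definition orbit_closure :: "int \<Rightarrow> int \<Rightarrow> real \<Rightarrow> real set" where
  "orbit_closure b d x = closure {of_int b ^ n * (of_int d * x) + of_int k | (n::nat) (k::int). True}"

text \<open>Level \<open>n\<close> holds the z for which z, z - s, ..., z - n s all lie in
  \<open>G\<close>. In the recursive form each level is the previous one intersected with its
  translate, so one closure property of equivariant families covers all levels.\<close>

primrec shift_chain :: "real \<Rightarrow> real set \<Rightarrow> nat \<Rightarrow> real set" where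
  "shift_chain s G 0 = G"
| "shift_chain s G (Suc n) = {z \<in> shift_chain s G n. z - s \<in> shift_chain s G n}"

text \<open>This reduces hits in the plane to countably many hits on the line. If the compact
  \<open>W\<close> missed the closed product, the two would have positive distance, which a fine
  rational approximation contradicts.\<close>

lemma meets_compact_iff_rational_approx:
  fixes W :: "(real \<times> real) set"
  assumes G: "closed G" and W: "compact W"
  shows "(G \<times> G) \<inter> W \<noteq> {} \<longleftrightarrow> (\<forall>j::nat. \<exists>p\<in>\<rat>. \<exists>r\<in>\<rat>.
    (\<exists>w\<in>W. \<bar>p - fst w\<bar> \<le> 1 / Suc j \<and> \<bar>r - snd w\<bar> \<le> 1 / Suc j) \<and>
    G \<inter> {p - 1 / Suc j..p + 1 / Suc j} \<noteq> {} \<and> G \<inter> {r - 1 / Suc j..r + 1 / Suc j} \<noteq> {})" (is "?L \<longleftrightarrow> ?R")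
proof
  have near: "\<exists>p\<in>\<rat>. \<bar>p - u\<bar> \<le> h" if "h > 0" for u h :: real
  proof -
    obtain p where "p \<in> \<rat>" "u < p" "p < u + h"
      using Rats_dense_in_real[of u "u + h"] \<open>h > 0\<close> by auto
    then show ?thesis by (intro bexI[of _ p]) auto
  qed
  assume ?L
  then obtain u v where uv: "u \<in> G" "v \<in> G" "(u, v) \<in> W" by auto
  show ?R
  proof
    fix j :: nat
    have h: "1 / real (Suc j) > 0" by simp
    obtain p where p: "p \<in> \<rat>" "\<bar>p - u\<bar> \<le> 1 / real (Suc j)" using near[OF h] by blast
    obtain r where r: "r \<in> \<rat>" "\<bar>r - v\<bar> \<le> 1 / real (Suc j)" using near[OF h] by blast
    have "u \<in> {p - 1 / Suc j..p + 1 / Suc j}" "v \<in> {r - 1 / Suc j..r + 1 / Suc j}"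
      using p(2) r(2) unfolding abs_le_iff atLeastAtMost_iff by linarith+
    then have ne: "G \<inter> {p - 1 / Suc j..p + 1 / Suc j} \<noteq> {}" "G \<inter> {r - 1 / Suc j..r + 1 / Suc j} \<noteq> {}"
      using uv by blast+
    have "\<exists>w\<in>W. \<bar>p - fst w\<bar> \<le> 1 / Suc j \<and> \<bar>r - snd w\<bar> \<le> 1 / Suc j"
      by (rule bexI[OF _ uv(3)]) (use p(2) r(2) in simp)
    then show "\<exists>p\<in>\<rat>. \<exists>r\<in>\<rat>. (\<exists>w\<in>W. \<bar>p - fst w\<bar> \<le> 1 / Suc j \<and> \<bar>r - snd w\<bar> \<le> 1 / Suc j) \<and>
        G \<inter> {p - 1 / Suc j..p + 1 / Suc j} \<noteq> {} \<and> G \<inter> {r - 1 / Suc j..r + 1 / Suc j} \<noteq> {}"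
      using ne by (intro bexI[OF _ p(1)] bexI[OF _ r(1)] conjI)
  qed
next
  assume R: ?R
  show ?L
  proof (rule ccontr)
    assume "\<not> ?L"
    then have "W \<inter> (G \<times> G) = {}" by auto
    then obtain e where e: "e > 0" "\<And>w g. w \<in> W \<Longrightarrow> g \<in> G \<times> G \<Longrightarrow> e \<le> dist w g"
      using separate_compact_closed[OF W closed_Times[OF G G]] by auto
    \<comment> \<open>Each of the two coordinates errs by at most two mesh widths, hence the
      quarter.\<close>
    obtain j where j: "1 / real (Suc j) < e / 4"
      using nat_approx_posE[of "e / 4"] e(1) by auto
    obtain p r w u v where *: "w \<in> W" "\<bar>p - fst w\<bar> \<le> 1 / Suc j" "\<bar>r - snd w\<bar> \<le> 1 / Suc j"
      "u \<in> G" "u \<in> {p - 1 / Suc j..p + 1 / Suc j}" "v \<in> G" "v \<in> {r - 1 / Suc j..r + 1 / Suc j}"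
      using R by (metis disjoint_iff)
    have "\<bar>fst w - u\<bar> \<le> 2 * (1 / Suc j)" "\<bar>snd w - v\<bar> \<le> 2 * (1 / Suc j)"
      using *(2,3,5,7) unfolding atLeastAtMost_iff by linarith+
    then have "\<bar>fst w - u\<bar> + \<bar>snd w - v\<bar> < e"
      using j by linarith
    moreover have "dist w (u, v) \<le> \<bar>fst w - u\<bar> + \<bar>snd w - v\<bar>"
      unfolding dist_prod_def dist_real_def by (simp add: sqrt_sum_squares_le_sum_abs)
    ultimately show False using e(2)[OF *(1), of "(u, v)"] *(4,6) by auto
  qed
qed

lemma sets_product_meets_compact:
  fixes W :: "(real \<times> real) set"
  assumes F: "equivariant_family \<mu> T a b F" and W: "compact W"
  shows "{x \<in> space \<mu>. (F x \<times> F x) \<inter> W \<noteq> {}} \<in> sets \<mu>"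
proof -
  have "{x \<in> space \<mu>. (F x \<times> F x) \<inter> W \<noteq> {}} = {x \<in> space \<mu>. (\<forall>j::nat. \<exists>p\<in>\<rat>. \<exists>r\<in>\<rat>.
    (\<exists>w\<in>W. \<bar>p - fst w\<bar> \<le> 1 / Suc j \<and> \<bar>r - snd w\<bar> \<le> 1 / Suc j) \<and>
    F x \<inter> {p - 1 / Suc j..p + 1 / Suc j} \<noteq> {} \<and> F x \<inter> {r - 1 / Suc j..r + 1 / Suc j} \<noteq> {})}"
    using meets_compact_iff_rational_approx[OF invariant_setD(1)[OF equivariant_familyD(1)[OF F]] W]
    by (intro Collect_cong conj_cong refl)
  also have "\<dots> \<in> sets \<mu>"
    by (intro sets.sets_Collect_countable_All sets.sets_Collect_countable_Ex' sets.sets_Collect_conj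
        sets.sets_Collect_const countable_rat equivariant_familyD(3)[OF F])
  finally show ?thesis .
qed

section \<open>Difference sets and intersections with translates\<close>

lemma invariant_set_diff_set:
  assumes G: "invariant_set b G"
  shows "invariant_set b (diff_set G)"
proof -
  note D = invariant_setD[OF G]
  \<comment> \<open>Differences of closed sets need not form a closed set; periodicity lets the
    second point be taken in the compact [0,1], and then they do.\<close>
  have "diff_set G = (\<Union>u\<in>G. \<Union>v\<in>G \<inter> {0..1}. {u - v})"
  proof (intro subset_antisym subsetI)
    fix z assume "z \<in> diff_set G"
    then obtain u v where uv: "u \<in> G" "v \<in> G" "z = u - v" unfolding diff_set_def by auto
    have "z = (u - of_int \<lfloor>v\<rfloor>) - frac v" unfolding uv frac_def by simp
    moreover have "u - of_int \<lfloor>v\<rfloor> \<in> G" using D(3) uv by auto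
    moreover have "frac v \<in> G \<inter> {0..1}"
      using D(6) uv frac_ge_0[of v] frac_lt_1[of v] by auto
    ultimately show "z \<in> (\<Union>u\<in>G. \<Union>v\<in>G \<inter> {0..1}. {u - v})" by blast
  qed (auto simp: diff_set_def)
  moreover have "closed (\<Union>u\<in>G. \<Union>v\<in>G \<inter> {0..1}. {u - v})"
    using D(1) by (intro closed_compact_differences closed_Int_compact) auto
  ultimately have "closed (diff_set G)" by simp
  moreover have "z + of_int k \<in> diff_set G" if z: "z \<in> diff_set G" for z and k :: int
  proof -
    obtain u v where uv: "u \<in> G" "v \<in> G" "z = u - v" using z unfolding diff_set_def by auto
    have "z + of_int k = (u + of_int k) - v" unfolding uv by simp
    then show ?thesis using D(2)[OF uv(1)] uv(2) unfolding diff_set_def by blast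
  qed
  moreover have "of_int b * z \<in> diff_set G" if z: "z \<in> diff_set G" for z
  proof -
    obtain u v where uv: "u \<in> G" "v \<in> G" "z = u - v" using z unfolding diff_set_def by auto
    have "of_int b * z = of_int b * u - of_int b * v" unfolding uv by (simp add: algebra_simps)
    then show ?thesis using D(4) uv(1,2) unfolding diff_set_def by blast
  qed
  ultimately show ?thesis unfolding invariant_set_def by auto
qed

lemma equivariant_family_diff_set:
  assumes F: "equivariant_family \<mu> T a b F"
  shows "equivariant_family \<mu> T a b (\<lambda>x. diff_set (F x))"
  unfolding equivariant_family_def
proof (intro conjI ballI allI)
  fix x assume x: "x \<in> space \<mu>"
  show "invariant_set b (diff_set (F x))"
    by (rule invariant_set_diff_set[OF equivariant_familyD(1)[OF F x]])
  fix z assume "z \<in> diff_set (F x)"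
  then obtain u v where uv: "u \<in> F x" "v \<in> F x" "z = u - v" unfolding diff_set_def by auto
  have "of_int a * z = of_int a * u - of_int a * v" unfolding uv by (simp add: algebra_simps)
  then show "of_int a * z \<in> diff_set (F (T x))"
    using equivariant_familyD(2)[OF F x] uv(1,2) unfolding diff_set_def by blast
next
  fix c d :: real
  \<comment> \<open>The same normalisation bounds both coordinates, so that \<open>W\<close> is
    compact.\<close>
  define W where "W = {w :: real \<times> real. snd w \<in> {0..1} \<and> fst w - snd w \<in> {c..d}}"
  have "closed W"
    unfolding W_def atLeastAtMost_iff
    by (intro closed_Collect_conj closed_Collect_le continuous_intros)
  moreover have "W \<subseteq> {c..d + 1} \<times> {0..1}"
    unfolding W_def by auto
  ultimately have W: "compact W"
    using bounded_subset[OF compact_imp_bounded[OF compact_Times[OF compact_Icc compact_Icc]]]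
    by (auto simp: compact_eq_bounded_closed)
  have "diff_set (F x) \<inter> {c..d} \<noteq> {} \<longleftrightarrow> (F x \<times> F x) \<inter> W \<noteq> {}" if x: "x \<in> space \<mu>" for x
  proof
    note D = invariant_setD[OF equivariant_familyD(1)[OF F x]]
    assume "diff_set (F x) \<inter> {c..d} \<noteq> {}"
    then obtain u v where uv: "u \<in> F x" "v \<in> F x" "u - v \<in> {c..d}"
      unfolding diff_set_def by blast
    have "u - of_int \<lfloor>v\<rfloor> \<in> F x" "frac v \<in> F x" using uv D by auto
    moreover have "(u - of_int \<lfloor>v\<rfloor>, frac v) \<in> W"
      using uv(3) frac_lt_1[of v] frac_ge_0[of v] unfolding W_def by (auto simp: frac_def)
    ultimately show "(F x \<times> F x) \<inter> W \<noteq> {}" by blast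
  next
    assume "(F x \<times> F x) \<inter> W \<noteq> {}"
    then show "diff_set (F x) \<inter> {c..d} \<noteq> {}" unfolding W_def diff_set_def by fastforce
  qed
  then have "{x \<in> space \<mu>. diff_set (F x) \<inter> {c..d} \<noteq> {}} = {x \<in> space \<mu>. (F x \<times> F x) \<inter> W \<noteq> {}}"
    by (intro Collect_cong conj_cong refl)
  then show "{x \<in> space \<mu>. diff_set (F x) \<inter> {c..d} \<noteq> {}} \<in> sets \<mu>"
    using sets_product_meets_compact[OF F W] by simp
qed

text \<open>A shift that \<open>c\<close> fixes modulo 1 commutes with multiplication by
  \<open>c\<close> on the circle.\<close>

lemma mult_minus_shift_mem:
  assumes "invariant_set b G" "of_int c * z - of_int c * s \<in> G" "of_int c * s - s \<in> \<int>"
  shows "of_int c * z - s \<in> G"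
proof -
  obtain k where "of_int c * s - s = of_int k" using assms(3) Ints_cases by metis
  then have eq: "of_int c * z - s = (of_int c * z - of_int c * s) + of_int k" by simp
  show ?thesis unfolding eq by (rule invariant_setD(2)[OF assms(1,2)])
qed

lemma equivariant_family_shift:
  assumes F: "equivariant_family \<mu> T a b F" and T: "T \<in> measurable \<mu> \<mu>"
    and s: "of_int a * s - s \<in> \<int>" "of_int b * s - s \<in> \<int>"
  shows "equivariant_family \<mu> T a b (\<lambda>x. {z \<in> F x. z - s \<in> F x})"
  unfolding equivariant_family_def
proof (intro conjI ballI allI)
  fix x assume x: "x \<in> space \<mu>"
  note I = equivariant_familyD(1)[OF F x]
  note D = invariant_setD[OF I]
  have "closed (F x \<inter> (\<lambda>z. z - s) -` F x)"
    using D(1) by (intro closed_Int closed_vimage continuous_intros) auto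
  moreover have "F x \<inter> (\<lambda>z. z - s) -` F x = {z \<in> F x. z - s \<in> F x}" by auto
  moreover have "z + of_int k - s \<in> F x" if "z - s \<in> F x" for z and k :: int
    using D(2)[OF that, of k] by (simp add: algebra_simps)
  moreover have "of_int b * z - s \<in> F x" if "z - s \<in> F x" for z
    using D(4)[OF that] mult_minus_shift_mem[OF I _ s(2)] by (simp add: right_diff_distrib)
  ultimately show "invariant_set b {z \<in> F x. z - s \<in> F x}"
    using D unfolding invariant_set_def by auto
  have Tx: "T x \<in> space \<mu>" using measurable_space[OF T x] .
  fix z assume z: "z \<in> {z \<in> F x. z - s \<in> F x}"
  then have "of_int a * z \<in> F (T x)" "of_int a * (z - s) \<in> F (T x)"
    using equivariant_familyD(2)[OF F x] by auto
  then show "of_int a * z \<in> {z \<in> F (T x). z - s \<in> F (T x)}"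
    using mult_minus_shift_mem[OF equivariant_familyD(1)[OF F Tx] _ s(1), of z] by (simp add: right_diff_distrib)
next
  fix c d :: real
  define W where "W = (\<lambda>u. (u, u - s)) ` {c..d}"
  have W: "compact W"
    unfolding W_def by (intro compact_continuous_image continuous_intros) auto
  have "{x \<in> space \<mu>. {z \<in> F x. z - s \<in> F x} \<inter> {c..d} \<noteq> {}} = {x \<in> space \<mu>. (F x \<times> F x) \<inter> W \<noteq> {}}"
    unfolding W_def by blast
  then show "{x \<in> space \<mu>. {z \<in> F x. z - s \<in> F x} \<inter> {c..d} \<noteq> {}} \<in> sets \<mu>"
    using sets_product_meets_compact[OF F W] by simp
qed

lemma equivariant_family_shift_chain:
  assumes F: "equivariant_family \<mu> T a b F" and T: "T \<in> measurable \<mu> \<mu>"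
    and s: "of_int a * s - s \<in> \<int>" "of_int b * s - s \<in> \<int>"
  shows "equivariant_family \<mu> T a b (\<lambda>x. shift_chain s (F x) n)"
proof (induction n)
  case 0
  then show ?case using F by simp
next
  case (Suc n)
  then show ?case using equivariant_family_shift[OF Suc T s] by simp
qed

section \<open>Orbit closures as an equivariant family\<close>

lemma closure_meets_interval_iff:
  fixes S :: "real set"
  assumes "c \<le> d"
  shows "closure S \<inter> {c..d} \<noteq> {} \<longleftrightarrow> (\<forall>j::nat. \<exists>y\<in>S. c - 1 / Suc j \<le> y \<and> y \<le> d + 1 / Suc j)"
proof
  assume "closure S \<inter> {c..d} \<noteq> {}"
  then obtain z where z: "z \<in> closure S" "c \<le> z" "z \<le> d" by auto
  show "\<forall>j::nat. \<exists>y\<in>S. c - 1 / Suc j \<le> y \<and> y \<le> d + 1 / Suc j"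
  proof
    fix j :: nat
    have "1 / real (Suc j) > 0" by simp
    then obtain y where y: "y \<in> S" "dist y z < 1 / real (Suc j)"
      using z(1) unfolding closure_approachable by blast
    then show "\<exists>y\<in>S. c - 1 / Suc j \<le> y \<and> y \<le> d + 1 / Suc j"
      using z unfolding dist_real_def abs_less_iff by (intro bexI[OF _ y(1)] conjI) linarith+
  qed
next
  assume R: "\<forall>j::nat. \<exists>y\<in>S. c - 1 / Suc j \<le> y \<and> y \<le> d + 1 / Suc j"
  show "closure S \<inter> {c..d} \<noteq> {}"
  proof (rule ccontr)
    assume "\<not> closure S \<inter> {c..d} \<noteq> {}"
    then have "{c..d} \<inter> closure S = {}" by auto
    then obtain e where e: "e > 0" "\<And>w g. w \<in> {c..d} \<Longrightarrow> g \<in> closure S \<Longrightarrow> e \<le> dist w g"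
      using separate_compact_closed[of "{c..d}" "closure S"] by auto
    obtain j where j: "1 / real (Suc j) < e"
      using nat_approx_posE[OF e(1)] by auto
    obtain y where y: "y \<in> S" "c - 1 / Suc j \<le> y" "y \<le> d + 1 / Suc j" using R by blast
    \<comment> \<open>The point of the interval nearest to \<open>y\<close>.\<close>
    have "max c (min d y) \<in> {c..d}" using assms by auto
    moreover have "dist (max c (min d y)) y < e"
      using y j e(1) assms unfolding dist_real_def max_def min_def abs_less_iff
      by (auto simp del: of_nat_Suc)
    ultimately show False using e(2) closure_subset[of S] y(1) by fastforce
  qed
qed

lemma continuous_image_closure_subset:
  assumes "continuous_on UNIV f" "f ` S \<subseteq> closure S'" "z \<in> closure S"
  shows "f z \<in> closure S'"
  using image_closure_subset[of S f "closure S'"] assms continuous_on_subset by blast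

lemma invariant_set_orbit_closure: "invariant_set b (orbit_closure b d x)"
proof -
  define S where "S = {of_int b ^ n * (of_int d * x) + of_int k | (n::nat) (k::int). True}"
  have "z + of_int k \<in> closure S" if z: "z \<in> closure S" for z and k :: int
  proof (rule continuous_image_closure_subset[OF _ _ z])
    show "(\<lambda>z. z + of_int k) ` S \<subseteq> closure S"
    proof (intro image_subsetI)
      fix y assume "y \<in> S"
      then obtain n l where "y = of_int b ^ n * (of_int d * x) + of_int l" unfolding S_def by auto
      then have "y + of_int k = of_int b ^ n * (of_int d * x) + of_int (l + k)" by simp
      then have "y + of_int k \<in> S" unfolding S_def by blast
      then show "y + of_int k \<in> closure S" using closure_subset by auto
    qed
  qed (intro continuous_intros)
  moreover have "of_int b * z \<in> closure S" if z: "z \<in> closure S" for z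
  proof (rule continuous_image_closure_subset[OF _ _ z])
    show "(*) (of_int b) ` S \<subseteq> closure S"
    proof (intro image_subsetI)
      fix y assume "y \<in> S"
      then obtain n l where "y = of_int b ^ n * (of_int d * x) + of_int l" unfolding S_def by auto
      then have "of_int b * y = of_int b ^ Suc n * (of_int d * x) + of_int (b * l)"
        by (simp add: algebra_simps)
      then have "of_int b * y \<in> S" unfolding S_def by blast
      then show "of_int b * y \<in> closure S" using closure_subset by auto
    qed
  qed (intro continuous_intros)
  ultimately show ?thesis
    unfolding invariant_set_def orbit_closure_def S_def[symmetric] by auto
qed

lemma equivariant_family_orbit_closure:
  assumes sets: "sets \<mu> = sets (restrict_space borel {0..1::real})"
  shows "equivariant_family \<mu> (times_map a) a b (orbit_closure b d)"
  unfolding equivariant_family_def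
proof (intro conjI ballI allI)
  fix x assume x: "x \<in> space \<mu>"
  show "invariant_set b (orbit_closure b d x)" by (rule invariant_set_orbit_closure)
  fix z assume z: "z \<in> orbit_closure b d x"
  show "of_int a * z \<in> orbit_closure b d (times_map a x)"
    unfolding orbit_closure_def
  proof (rule continuous_image_closure_subset[OF _ _ z[unfolded orbit_closure_def]])
    define S where "S = {of_int b ^ n * (of_int d * times_map a x) + of_int k | (n::nat) (k::int). True}"
    show "(*) (of_int a) ` {of_int b ^ n * (of_int d * x) + of_int k | (n::nat) (k::int). True} \<subseteq> closure S"
    proof (intro image_subsetI)
      fix y assume "y \<in> {of_int b ^ n * (of_int d * x) + of_int k | (n::nat) (k::int). True}"
      then obtain n and l :: int where y: "y = of_int b ^ n * (of_int d * x) + of_int l" by auto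
      \<comment> \<open>Replacing a x by its fractional part changes the expression by an integer
        only.\<close>
      have "of_int a * y = of_int b ^ n * (of_int d * times_map a x) + of_int (b ^ n * d * \<lfloor>of_int a * x\<rfloor> + a * l)"
        unfolding y times_map_def frac_def by (simp add: algebra_simps)
      then have "of_int a * y \<in> S" unfolding S_def by blast
      then show "of_int a * y \<in> closure S" using closure_subset by auto
    qed
  qed (intro continuous_intros)
next
  fix c e :: real
  have id: "(\<lambda>x. x) \<in> borel_measurable \<mu>"
    unfolding measurable_cong_sets[OF sets refl]
    by (rule measurable_restrict_space1) simp
  show "{x \<in> space \<mu>. orbit_closure b d x \<inter> {c..e} \<noteq> {}} \<in> sets \<mu>"
  proof (cases "c \<le> e")
    case True
    have "{x \<in> space \<mu>. orbit_closure b d x \<inter> {c..e} \<noteq> {}} = {x \<in> space \<mu>. \<forall>j::nat. \<exists>n::nat. \<exists>k::int.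
       c - 1 / Suc j \<le> of_int b ^ n * (of_int d * x) + of_int k \<and> of_int b ^ n * (of_int d * x) + of_int k \<le> e + 1 / Suc j}"
      unfolding orbit_closure_def closure_meets_interval_iff[OF True] by blast
    also have "\<dots> \<in> sets \<mu>"
      using id by measurable
    finally show ?thesis .
  qed auto
qed

section \<open>Density of orbits\<close>

text \<open>The orbit of an irrational point has no repetition modulo 1, since a coincidence could
  be solved for a rational value. Among \<open>N + 1\<close> orbit points two share a box of width
  1/N, and ordering them makes the difference positive.\<close>

lemma accumulates_at_zero_diff_set:
  assumes G: "invariant_set b G" and b: "b \<ge> 2" and g: "g \<in> G" "g \<notin> \<rat>"
  shows "accumulates_at_zero (diff_set G)"
  unfolding accumulates_at_zero_def
proof (intro allI impI)
  fix \<epsilon> :: real assume "\<epsilon> > 0"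
  obtain N where N: "N > 0" "1 / real N < \<epsilon>"
    by (metis \<open>\<epsilon> > 0\<close> gr_zeroI inverse_eq_divide real_arch_inverse)
  define f where "f n = frac (of_int b ^ n * g)" for n :: nat
  have fG: "f n \<in> G" for n
    unfolding f_def using invariant_setD[OF G] g(1) by blast
  have f_inj: "f i \<noteq> f j" if "i \<noteq> j" for i j
  proof
    assume "f i = f j"
    then have "(of_int (b ^ i) - of_int (b ^ j)) * g = of_int (\<lfloor>of_int b ^ i * g\<rfloor> - \<lfloor>of_int b ^ j * g\<rfloor>)"
      unfolding f_def frac_def by (simp add: algebra_simps)
    moreover have "b ^ i \<noteq> b ^ j"
      using that b by (simp add: power_inject_exp)
    then have "real_of_int (b ^ i) - of_int (b ^ j) \<noteq> 0" by (simp flip: of_int_power)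
    ultimately have "g = of_int (\<lfloor>of_int b ^ i * g\<rfloor> - \<lfloor>of_int b ^ j * g\<rfloor>) / (of_int (b ^ i) - of_int (b ^ j))"
      by (simp add: field_simps)
    then have "g \<in> \<rat>" by (metis Rats_diff Rats_divide Rats_of_int)
    then show False using g by simp
  qed
  define h where "h n = \<lfloor>real N * f n\<rfloor>" for n
  have f01: "0 \<le> f n" "f n < 1" for n unfolding f_def by (auto simp: frac_lt_1)
  have "h n \<in> {0..<int N}" for n
    unfolding h_def using f01[of n] N(1) by (auto simp: floor_less_iff)
  then have "card (h ` {..N}) \<le> card {0..<int N}"
    by (intro card_mono) auto
  then have "\<not> inj_on h {..N}"
    by (intro pigeonhole) auto
  then obtain i j where ij: "i \<noteq> j" "h i = h j" unfolding inj_on_def by blast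
  have "\<exists>i j. h i = h j \<and> f i < f j"
    using ij f_inj[OF ij(1)] by (metis linorder_neqE_linordered_idom)
  then obtain i j where ij: "h i = h j" "f i < f j" by blast
  have "of_int (h i) \<le> real N * f i" "real N * f j < of_int (h j) + 1"
    unfolding h_def by linarith+
  then have "real N * (f j - f i) < 1"
    using ij(1) by (simp add: right_diff_distrib)
  then have "f j - f i < 1 / real N"
    using N(1) by (simp add: field_simps)
  moreover have "f j - f i \<in> diff_set G" unfolding diff_set_def using fG by blast
  ultimately show "\<exists>y\<in>diff_set G. 0 < y \<and> y < \<epsilon>"
    using ij(2) N(2) by (intro bexI[of _ "f j - f i"]) auto
qed

text \<open>Multiplying by the denominator of \<open>r\<close> moves the limit point to an integer,
  hence to 0 modulo 1, and irrationality of \<open>x\<close> keeps the orbit from landing on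
  it.\<close>

lemma orbit_closure_rational_imp_accumulates:
  assumes x: "x \<notin> \<rat>" and b: "b \<ge> 2" and r: "r \<in> \<rat>" "r \<in> orbit_closure b 1 x"
  obtains d where "d \<noteq> 0" "accumulates_at_zero (orbit_closure b d x)"
proof -
  obtain p d :: int where pd: "d > 0" "r = of_int p / of_int d"
    using r(1) by (metis Rats_cases')
  define S where "S e = {of_int b ^ n * (of_int e * x) + of_int k | (n::nat) (k::int). True}" for e :: int
  have S: "S e \<subseteq> orbit_closure b e x" for e
    unfolding S_def orbit_closure_def by (rule closure_subset)
  have near: "\<exists>t\<in>S d. t \<noteq> 0 \<and> \<bar>t\<bar> < \<epsilon>" if \<epsilon>: "\<epsilon> > 0" for \<epsilon>
  proof -
    have "\<epsilon> / of_int d > 0" using \<epsilon> pd by simp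
    then obtain y where y: "y \<in> S 1" "dist y r < \<epsilon> / of_int d"
      using r(2) unfolding orbit_closure_def S_def closure_approachable by blast
    obtain n k where nk: "y = of_int b ^ n * x + of_int k" using y(1) unfolding S_def by auto
    define t where "t = of_int b ^ n * (of_int d * x) + of_int (d * k - p)"
    have t: "t = of_int d * (y - r)"
      unfolding t_def nk pd(2) using pd(1) by (simp add: field_simps)
    have "t \<in> S d" unfolding S_def t_def by blast
    moreover have "\<bar>t\<bar> < \<epsilon>"
      using y(2) pd(1) unfolding t abs_mult dist_real_def by (simp add: field_simps)
    moreover have "t \<noteq> 0"
    proof
      assume "t = 0"
      then have "y = r" using t pd(1) by simp
      then have "x = (r - of_int k) / of_int b ^ n"
        using nk b by (simp add: field_simps)
      then show False using x r(1) by simp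
    qed
    ultimately show ?thesis by blast
  qed
  show thesis
  proof (cases "\<forall>\<epsilon>>0. \<exists>t\<in>S d. 0 < t \<and> t < \<epsilon>")
    case True
    then have "accumulates_at_zero (orbit_closure b d x)"
      unfolding accumulates_at_zero_def using S by blast
    then show thesis using that[of d] pd(1) by simp
  next
    case False
    \<comment> \<open>There is a gap to the right of 0, so the small points of \<open>S d\<close>
      are negative and their negatives lie in \<open>S (- d)\<close>.\<close>
    then obtain \<epsilon>0 where \<epsilon>0: "\<epsilon>0 > 0" "\<And>t. t \<in> S d \<Longrightarrow> 0 < t \<Longrightarrow> \<not> t < \<epsilon>0" by blast
    have "accumulates_at_zero (orbit_closure b (- d) x)"
      unfolding accumulates_at_zero_def
    proof (intro allI impI)
      fix \<epsilon> :: real assume "\<epsilon> > 0"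
      then have "min \<epsilon> \<epsilon>0 > 0" using \<epsilon>0 by simp
      then obtain t where t: "t \<in> S d" "t \<noteq> 0" "\<bar>t\<bar> < min \<epsilon> \<epsilon>0" using near by blast
      then have "t < 0" using \<epsilon>0(2)[of t] by linarith
      obtain n k where nk: "t = of_int b ^ n * (of_int d * x) + of_int k" using t(1) unfolding S_def by auto
      have "- t = of_int b ^ n * (of_int (- d) * x) + of_int (- k)" unfolding nk by simp
      then have "- t \<in> S (- d)" unfolding S_def by blast
      then show "\<exists>y\<in>orbit_closure b (- d) x. 0 < y \<and> y < \<epsilon>"
        using S[of "-d"] t \<open>t < 0\<close> by (intro bexI[of _ "- t"]) auto
    qed
    then show thesis using that[of "- d"] pd(1) by simp
  qed
qed

text \<open>If the closure \<open>C\<close> for \<open>x\<close> were proper it would be null, and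
  so would be the finitely many closed affine images d C + i that cover the orbit of d x.\<close>

lemma orbit_closure_UNIV_of_multiple:
  assumes b: "b \<ge> 2" and d: "d \<noteq> 0" and U: "orbit_closure b d x = UNIV"
  shows "orbit_closure b 1 x = UNIV"
proof (rule ccontr)
  define C where "C = orbit_closure b 1 x"
  assume "orbit_closure b 1 x \<noteq> UNIV"
  then have neg: "negligible C"
    unfolding C_def using invariant_set_null[OF invariant_set_orbit_closure b] by blast
  have cl: "closed C" unfolding C_def orbit_closure_def by simp
  define K where "K i = {w. (w - of_int i) / of_int d \<in> C}" for i :: int
  define L where "L = (\<Union>i\<in>{-\<bar>d\<bar>..\<bar>d\<bar>}. K i)"
  have Kc: "closed (K i)" for i
  proof -
    have "closed ((\<lambda>w. (w - of_int i) / of_int d) -` C)"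
      using d by (intro closed_vimage[OF cl] continuous_intros) auto
    then show ?thesis unfolding K_def vimage_def .
  qed
  have Kn: "negligible (K i)" for i
  proof -
    have "K i \<subseteq> (\<lambda>w. of_int d * w + of_int i) ` C"
    proof
      fix w assume "w \<in> K i"
      then show "w \<in> (\<lambda>w. of_int d * w + of_int i) ` C"
        using d unfolding K_def by (intro image_eqI[of _ _ "(w - of_int i) / of_int d"]) auto
    qed
    moreover have "negligible ((\<lambda>w. of_int d * w + of_int i) ` C)"
      using neg by (intro negligible_differentiable_image_negligible) (auto intro!: derivative_intros)
    ultimately show ?thesis by (rule negligible_subset[rotated])
  qed
  have "{of_int b ^ n * (of_int d * x) + of_int k | (n::nat) (k::int). True} \<subseteq> L"
  proof
    fix y assume "y \<in> {of_int b ^ n * (of_int d * x) + of_int k | (n::nat) (k::int). True}"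
    then obtain n and k :: int where y: "y = of_int b ^ n * (of_int d * x) + of_int k" by auto
    \<comment> \<open>The quotient becomes an integer translation inside \<open>C\<close>, and the
      remainder selects the copy. It may be negative when \<open>d\<close> is, hence the symmetric
      range of \<open>i\<close>.\<close>
    have "real_of_int k = of_int d * of_int (k div d) + of_int (k mod d)"
      by (metis mult_div_mod_eq of_int_add of_int_mult)
    then have "(y - of_int (k mod d)) / of_int d = of_int b ^ n * (of_int 1 * x) + of_int (k div d)"
      unfolding y using d by (simp add: field_simps)
    also have "\<dots> \<in> C"
      unfolding C_def orbit_closure_def by (rule subsetD[OF closure_subset]) blast
    finally have "y \<in> K (k mod d)" unfolding K_def by simp
    moreover have "k mod d \<in> {-\<bar>d\<bar>..\<bar>d\<bar>}"
      using abs_mod_less[OF d, of k] by auto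
    ultimately show "y \<in> L" unfolding L_def by blast
  qed
  moreover have "closed L" unfolding L_def using Kc by (intro closed_UN) auto
  ultimately have "orbit_closure b d x \<subseteq> L" unfolding orbit_closure_def by (rule closure_minimal)
  moreover have "negligible L" unfolding L_def using Kn by (intro negligible_Union) auto
  ultimately show False using U negligible_subset non_negligible_UNIV by metis
qed

section \<open>Progressions of step 1/q in an orbit closure\<close>

lemma shift_chain_mem:
  assumes "z \<in> shift_chain s G n" "i \<le> n"
  shows "z - real i * s \<in> G"
  using assms
proof (induction n arbitrary: z i)
  case 0
  then show ?case by simp
next
  case (Suc n)
  show ?case
  proof (cases i)
    case 0
    then show ?thesis using Suc.IH[of z 0] Suc.prems by simp
  next
    case (Suc i')
    then have "z - s - real i' * s \<in> G"
      using Suc.IH[of "z - s" i'] Suc.prems by simp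
    then show ?thesis using Suc by (simp add: algebra_simps)
  qed
qed

text \<open>An irrational point at level \<open>n\<close> makes the difference set accumulate at 0,
  hence fill the line by the last hypothesis. It then contains \<open>s\<close>, and a pair with
  difference \<open>s\<close> gives a point of the next level.\<close>

lemma shift_chain_nonempty:
  assumes "b \<ge> 2" and inv: "\<And>n. invariant_set b (shift_chain s G n)" and "G \<noteq> {}" and irr: "G \<inter> \<rat> = {}"
    and full: "\<And>n. accumulates_at_zero (diff_set (shift_chain s G n)) \<Longrightarrow> diff_set (shift_chain s G n) = UNIV"
  shows "shift_chain s G n \<noteq> {}"
proof (induction n)
  case 0
  then show ?case using assms by simp
next
  case (Suc n)
  then obtain g where g: "g \<in> shift_chain s G n" by auto
  then have "g \<notin> \<rat>" using shift_chain_mem[OF g, of 0] irr by auto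
  then have "diff_set (shift_chain s G n) = UNIV"
    using full accumulates_at_zero_diff_set[OF inv assms(1) g] by blast
  then have "s \<in> diff_set (shift_chain s G n)" by simp
  then obtain u v where uv: "u \<in> shift_chain s G n" "v \<in> shift_chain s G n" "s = u - v"
    unfolding diff_set_def by blast
  then have "u \<in> shift_chain s G (Suc n)" by simp
  then show ?case by blast
qed

text \<open>Modulo 1, the points c - i/q form a complete grid of mesh 1/q in
  \<open>G\<close>.\<close>

lemma shift_chain_nonempty_imp_dense:
  assumes G: "invariant_set b G" and q: "q > 0" and ne: "shift_chain (1 / real q) G q \<noteq> {}"
  shows "\<exists>y\<in>G. \<bar>y - z\<bar> < 1 / real q"
proof -
  obtain c where c: "c \<in> shift_chain (1 / real q) G q" using ne by blast
  define w where "w = c - z"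
  define i where "i = nat \<lfloor>real q * frac w\<rfloor>"
  have fw: "0 \<le> frac w" "frac w < 1" by (auto simp: frac_lt_1)
  have i: "real i \<le> real q * frac w" "real q * frac w < real i + 1"
    unfolding i_def using fw by auto
  moreover have "real q * frac w < real q" using fw q by simp
  ultimately have "i \<le> q" by linarith
  then have "c - real i * (1 / real q) - of_int \<lfloor>w\<rfloor> \<in> G"
    using invariant_setD(3)[OF G] shift_chain_mem[OF c] by blast
  moreover have "c - real i * (1 / real q) - of_int \<lfloor>w\<rfloor> - z = (real q * frac w - real i) / real q"
    using q unfolding frac_def w_def by (simp add: field_simps)
  moreover have "\<bar>(real q * frac w - real i) / real q\<bar> < 1 / real q"
    using i q by (simp add: abs_of_nonneg divide_strict_right_mono)
  ultimately show ?thesis by metis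
qed

text \<open>By Euler's theorem this power of \<open>c\<close> is 1 modulo \<open>q\<close>, so it
  fixes 1/q on the circle, as shifts in an equivariant family require.\<close>

lemma power_totient_shift:
  assumes "coprime c (int q)" "q > 1"
  shows "of_int (c ^ totient q) * (1 / real q) - 1 / real q \<in> \<int>"
proof -
  interpret residues "int q" "residue_ring (int q)"
    using assms by unfold_locales auto
  have "[c ^ totient q = 1] (mod int q)"
    using euler_theorem[OF assms(1)] by simp
  then have "int q dvd c ^ totient q - 1" by (simp add: cong_iff_dvd_diff)
  then obtain k where "c ^ totient q - 1 = int q * k" by (elim dvdE)
  then have "real_of_int (c ^ totient q) = 1 + real q * of_int k"
    by (metis add.commute diff_eq_eq of_int_1 of_int_add of_int_mult of_int_of_nat_eq)
  then have "of_int (c ^ totient q) * (1 / real q) - 1 / real q = of_int k"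
    using assms(2) by (simp add: field_simps)
  then show ?thesis by simp
qed

lemma AE_not_rational:
  assumes sets: "sets \<mu> = sets (restrict_space borel {0..1::real})" and na: "non_atomic \<mu>"
  shows "AE x in \<mu>. x \<notin> \<rat>"
proof -
  have sp: "space \<mu> = {0..1}"
    using sets_eq_imp_space_eq[OF sets] by (simp add: space_restrict_space)
  have "AE x in \<mu>. x \<noteq> r" for r
  proof (cases "r \<in> space \<mu>")
    case True
    have "{r} \<in> sets \<mu>"
      unfolding sets using True sp by (simp add: sets_restrict_space_iff)
    moreover have "\<not> is_atom \<mu> {r}" using na unfolding non_atomic_def by blast
    ultimately have "emeasure \<mu> {r} = 0"
      unfolding is_atom_def by (auto simp: subset_singleton_iff)
    then have "{r} \<in> null_sets \<mu>" using \<open>{r} \<in> sets \<mu>\<close> by auto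
    then show ?thesis using AE_not_in by fastforce
  next
    case False
    then show ?thesis by (intro AE_I2) auto
  qed
  then have "AE x in \<mu>. \<forall>r\<in>\<rat>. x \<noteq> r"
    by (simp add: AE_ball_countable countable_rat)
  then show ?thesis by (rule AE_mp) auto
qed

lemma AE_orbit_closure_UNIV:
  assumes a: "a \<ge> 2" and b: "b \<ge> 2" and ind: "multiplicatively_independent a b"
    and sets: "sets \<mu> = sets (restrict_space borel {0..1::real})"
    and pr: "prob_space \<mu>" and na: "non_atomic \<mu>" and inv: "invariant_under \<mu> (times_map a)"
  shows "AE x in \<mu>. orbit_closure b 1 x = UNIV"
proof -
  have T: "times_map a \<in> measurable \<mu> \<mu>" using inv unfolding invariant_under_def by auto
  note fam = equivariant_family_orbit_closure[OF sets]
  \<comment> \<open>Numbers that are 1 modulo a b are coprime to both bases, and these tend to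
    infinity.\<close>
  define q where "q j = nat (a * b * int (Suc j) + 1)" for j
  have intq: "int (q j) = a * b * int (Suc j) + 1" for j
    unfolding q_def using a b by simp
  have q1: "q j > 1" "q j > Suc j" for j
  proof -
    have "a * b \<ge> 1" using mult_mono[of 1 a 1 b] a b by simp
    then have "a * b * int (Suc j) \<ge> 1 * int (Suc j)"
      by (intro mult_right_mono) auto
    then have "int (q j) > int (Suc j)" unfolding intq by simp
    then show "q j > Suc j" "q j > 1" by auto
  qed
  have cop: "coprime a (int (q j))" "coprime b (int (q j))" for j
  proof -
    have "coprime c (c * m + 1)" for c m :: int
      by (rule coprimeI) (simp add: dvd_add_right_iff dvd_mult2)
    from this[of a "b * int (Suc j)"] this[of b "a * int (Suc j)"] show "coprime a (int (q j))" "coprime b (int (q j))"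
      unfolding intq by (simp_all only: mult.assoc mult.left_commute)
  qed
  define k where "k j = totient (q j)" for j
  have k0: "k j > 0" for j unfolding k_def using q1(1)[of j] by simp
  have k2: "c ^ k j \<ge> 2" if "c \<ge> 2" for c :: int and j
    using that self_le_power[of c "k j"] k0[of j] by simp
  define G where "G j n x = shift_chain (1 / real (q j)) (orbit_closure b 1 x) n" for j n x
  have Gfam: "equivariant_family \<mu> (times_map a ^^ k j) (a ^ k j) (b ^ k j) (G j n)" for j n
    unfolding G_def
  proof (rule equivariant_family_shift_chain)
    show "equivariant_family \<mu> (times_map a ^^ k j) (a ^ k j) (b ^ k j) (orbit_closure b 1)"
      by (rule equivariant_family_power[OF fam T])
    show "times_map a ^^ k j \<in> measurable \<mu> \<mu>"
      using invariant_under_funpow[OF inv] unfolding invariant_under_def by auto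
    show "of_int (a ^ k j) * (1 / real (q j)) - 1 / real (q j) \<in> \<int>"
      "of_int (b ^ k j) * (1 / real (q j)) - 1 / real (q j) \<in> \<int>"
      unfolding k_def using power_totient_shift cop q1(1) by blast+
  qed
  \<comment> \<open>All exceptional null sets are collected before x is fixed: \<open>d\<close>
    here, and \<open>j\<close> and \<open>n\<close> below, range over countable types.\<close>
  have A1: "AE x in \<mu>. \<forall>d. accumulates_at_zero (orbit_closure b d x) \<longrightarrow> orbit_closure b d x = UNIV"
    unfolding AE_all_countable using AE_UNIV_if_accumulates[OF pr inv a b ind fam] by blast
  have A2: "AE x in \<mu>. \<forall>j n. accumulates_at_zero (diff_set (G j n x)) \<longrightarrow> diff_set (G j n x) = UNIV"
    unfolding AE_all_countable
    using AE_UNIV_if_accumulates[OF pr invariant_under_funpow[OF inv] k2[OF a] k2[OF b]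
        multiplicatively_independent_power[OF ind k0] equivariant_family_diff_set[OF Gfam]]
    by blast
  show ?thesis
    using A1 A2 AE_not_rational[OF sets na] AE_space
  proof eventually_elim
    case (elim x)
    define C where "C = orbit_closure b 1 x"
    have C: "invariant_set b C" unfolding C_def by (rule invariant_set_orbit_closure)
    show ?case
    proof (cases "C \<inter> \<rat> = {}")
      case False
      then obtain r where "r \<in> \<rat>" "r \<in> orbit_closure b 1 x" unfolding C_def by auto
      then obtain d where "d \<noteq> 0" "accumulates_at_zero (orbit_closure b d x)"
        using orbit_closure_rational_imp_accumulates[OF elim(3) b] by blast
      then show ?thesis using elim(1) orbit_closure_UNIV_of_multiple[OF b] by blast
    next
      case True
      have "C \<noteq> {}" unfolding C_def orbit_closure_def by auto
      have dense: "\<exists>y\<in>C. \<bar>y - z\<bar> < 1 / real (q j)" for z j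
      proof -
        have "G j n x \<noteq> {}" for n
          unfolding G_def
        proof (rule shift_chain_nonempty)
          show "b ^ k j \<ge> 2" by (rule k2[OF b])
          show "invariant_set (b ^ k j) (shift_chain (1 / real (q j)) (orbit_closure b 1 x) n)" for n
            using equivariant_familyD(1)[OF Gfam[of j n] elim(4)] unfolding G_def .
        qed (use \<open>C \<noteq> {}\<close> True elim(2) in \<open>auto simp: C_def G_def\<close>)
        then show ?thesis
          using shift_chain_nonempty_imp_dense[OF C, of "q j" z] q1(1)[of j]
          unfolding C_def G_def by auto
      qed
      have "z \<in> closure C" for z
        unfolding closure_approachable
      proof (intro allI impI)
        fix e :: real assume "e > 0"
        then obtain j where j: "1 / real (Suc j) < e" using nat_approx_posE by blast
        obtain y where y: "y \<in> C" "\<bar>y - z\<bar> < 1 / real (q j)" using dense by blast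
        have "1 / real (q j) \<le> 1 / real (Suc j)"
          using q1(2)[of j] by (intro divide_left_mono) auto
        then show "\<exists>y\<in>C. dist y z < e"
          using y j by (intro bexI[OF _ y(1)]) (simp add: dist_real_def)
      qed
      then show ?thesis using invariant_setD(1)[OF C] unfolding C_def by auto
    qed
  qed
qed

section \<open>Return to the orbit in the unit interval\<close>

lemma times_map_funpow:
  assumes "0 \<le> x" "x < 1"
  shows "(times_map b ^^ n) x = frac (of_int b ^ n * x)"
proof (induction n)
  \<comment> \<open>This is where x < 1 matters: at x = 1 the left side would be 1 and the right
    side 0.\<close>
  case 0
  then show ?case using assms by (simp add: frac_eq)
next
  case (Suc n)
  have "of_int b * frac (of_int b ^ n * x) = of_int b ^ Suc n * x - of_int (b * \<lfloor>of_int b ^ n * x\<rfloor>)"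
    unfolding frac_def by (simp add: algebra_simps)
  moreover have "frac (u - of_int m) = frac u" for u :: real and m
    by (simp add: frac_def)
  ultimately have "frac (of_int b * frac (of_int b ^ n * x)) = frac (of_int b ^ Suc n * x)"
    by (simp only:)
  then show ?case using Suc by (simp add: times_map_def)
qed

lemma orbit_dense_if_orbit_closure_UNIV:
  assumes x: "0 \<le> x" "x < 1" and U: "orbit_closure b 1 x = UNIV"
  shows "closure (orbit_of (times_map b) x) = {0..1}"
proof
  have orb: "orbit_of (times_map b) x = range (\<lambda>n. frac (of_int b ^ n * x))"
    unfolding orbit_of_def times_map_funpow[OF x] by auto
  show "closure (orbit_of (times_map b) x) \<subseteq> {0..1}"
    unfolding orb by (intro closure_minimal) (auto simp: frac_lt_1 less_imp_le)
  have "{0<..<1} \<subseteq> closure (orbit_of (times_map b) x)"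
  proof
    fix z :: real assume z: "z \<in> {0<..<1}"
    show "z \<in> closure (orbit_of (times_map b) x)"
      unfolding closure_approachable
    proof (intro allI impI)
      fix e :: real assume "e > 0"
      \<comment> \<open>Points this close to an interior \<open>z\<close> stay in (0,1), so they
        equal their own fractional part and the integer \<open>k\<close> disappears.\<close>
      then have "min e (min z (1 - z)) > 0" using z by auto
      moreover have "z \<in> orbit_closure b 1 x" using U by simp
      ultimately obtain y where y: "y \<in> {of_int b ^ n * (of_int 1 * x) + of_int k | (n::nat) (k::int). True}"
        "dist y z < min e (min z (1 - z))"
        unfolding orbit_closure_def closure_approachable by blast
      obtain n k where nk: "y = of_int b ^ n * x + of_int k" using y(1) by auto
      have "0 \<le> y" "y < 1" using y(2) z unfolding dist_real_def by auto
      then have "y = frac y" by (simp add: frac_eq)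
      also have "\<dots> = frac (of_int b ^ n * x)" unfolding nk by simp
      finally have "y \<in> orbit_of (times_map b) x" unfolding orb by auto
      then show "\<exists>y\<in>orbit_of (times_map b) x. dist y z < e" using y(2) by auto
    qed
  qed
  then have "closure {0<..<1::real} \<subseteq> closure (orbit_of (times_map b) x)"
    by (intro closure_minimal) auto
  then show "{0..1} \<subseteq> closure (orbit_of (times_map b) x)" by simp
qed

theorem theorem1p2:
  fixes a b :: int and \<mu> :: "real measure"
  assumes "a \<ge> 2" and "b \<ge> 2"
    and "multiplicatively_independent a b"
    and "sets \<mu> = sets (restrict_space borel {0..1})"
    and "prob_space \<mu>"
    and "non_atomic \<mu>"
    and "invariant_under \<mu> (times_map a)"
    and "ergodic_under \<mu> (times_map a)"
  shows "AE x in \<mu>. closure (orbit_of (times_map b) x) = {0..1}"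
proof -
  have sp: "space \<mu> = {0..1}"
    using sets_eq_imp_space_eq[OF assms(4)] by (simp add: space_restrict_space)
  show ?thesis
    using AE_orbit_closure_UNIV[OF assms(1-7)] AE_not_rational[OF assms(4,6)] AE_space
  proof eventually_elim
    case (elim x)
    \<comment> \<open>The endpoint 1 is rational, so it is among the excluded points.\<close>
    then have "0 \<le> x" "x < 1" using sp by (auto simp: order_less_le)
    then show ?case using orbit_dense_if_orbit_closure_UNIV elim(1) by blast
  qed
qed

end
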